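(* For any graph $G$, $\mathsf{mtw}(G) \le 2\cdot\mathsf{tw}(G) + 1$.
   Context: A tree decomposition of $G$ is a tree $T$ with bags $B(t)\subseteq V(G)$ such that every edge of $G$ lies in some bag and, for each vertex, the bags containing it form a nonempty connected subtree; its width is the maximum bag size minus one; $\mathsf{tw}(G)$ is the minimum width of a tree decomposition. A bag is matched if the subgraph of $G$ induced by the bag has a perfect matching, or has a matching leaving exactly one vertex $v$ of the bag unmatched with $v$ adjacent to some matched vertex. A matched tree decomposition is one all of whose bags are matched; $\mathsf{mtw}(G)$ is the minimum width of a matched tree decomposition.
   Formalization: The graph G is assumed to have no isolated vertex: a bag containing an isolated vertex is never matched, so a graph with one (e.g. a single vertex) has no matched tree decomposition and mtw(G) is undefined. *)

theory Defs
  imports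
    "HOL-Library.Extended_Real"
    "Graph_Theory.Graph_Theory"
begin

text \<open>
  Graphs are finite simple graphs in the sense of the locale \<open>graph\<close>: an undirected edge is a
  pair of opposite arcs.  The library constant \<open>tree\<close> is not usable here, since \<open>forest\<close> forbids
  directed cycles, and a symmetric digraph with an edge \<open>u v\<close> always has the directed cycle
  \<open>u v u\<close>.  Cycles of an undirected graph are those with at least three arcs.
\<close>

definition undirected_tree :: "('a, 'b) pre_digraph \<Rightarrow> bool" where
  "undirected_tree T \<longleftrightarrow>
     graph T \<and> Digraph_Component.connected T \<and>
     \<not> (\<exists>p. pre_digraph.cycle T p \<and> length p \<ge> 3)"

text \<open>
  Trees are finite, so it is no restriction to take their nodes from the natural numbers.  The
  library's \<open>connected\<close> includes nonemptiness of the vertex set.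
\<close>

definition tree_decomposition ::
  "('a, 'b) pre_digraph \<Rightarrow> nat pair_pre_digraph \<Rightarrow> (nat \<Rightarrow> 'a set) \<Rightarrow> bool" where
  "tree_decomposition G T B \<longleftrightarrow>
     undirected_tree (with_proj T) \<and>
     (\<forall>t\<in>pverts T. B t \<subseteq> verts G) \<and>
     (\<forall>u v. u \<rightarrow>\<^bsub>G\<^esub> v \<longrightarrow> (\<exists>t\<in>pverts T. u \<in> B t \<and> v \<in> B t)) \<and>
     (\<forall>v\<in>verts G. Digraph_Component.connected (with_proj T \<restriction> {t \<in> pverts T. v \<in> B t}))"

text \<open>Integer-valued: the decomposition of the null graph by empty bags has width \<open>-1\<close>.\<close>

definition td_width :: "nat pair_pre_digraph \<Rightarrow> (nat \<Rightarrow> 'a set) \<Rightarrow> int" where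
  "td_width T B = Max ((\<lambda>t. int (card (B t))) ` pverts T) - 1"

definition undirected_edges :: "('a, 'b) pre_digraph \<Rightarrow> 'a set set" where
  "undirected_edges G = {{u, v} | u v. u \<rightarrow>\<^bsub>G\<^esub> v}"

definition matching :: "('a, 'b) pre_digraph \<Rightarrow> 'a set set \<Rightarrow> bool" where
  "matching G M \<longleftrightarrow> M \<subseteq> undirected_edges G \<and> pairwise disjnt M"

definition matched_bag :: "('a, 'b) pre_digraph \<Rightarrow> 'a set \<Rightarrow> bool" where
  "matched_bag G S \<longleftrightarrow>
     (\<exists>M. matching (G \<restriction> S) M \<and> \<Union>M = S) \<or>
     (\<exists>M. \<exists>v\<in>S. matching (G \<restriction> S) M \<and> \<Union>M = S - {v} \<and> (\<exists>u\<in>\<Union>M. v \<rightarrow>\<^bsub>G\<^esub> u))"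

definition matched_tree_decomposition ::
  "('a, 'b) pre_digraph \<Rightarrow> nat pair_pre_digraph \<Rightarrow> (nat \<Rightarrow> 'a set) \<Rightarrow> bool" where
  "matched_tree_decomposition G T B \<longleftrightarrow>
     tree_decomposition G T B \<and> (\<forall>t\<in>pverts T. matched_bag G (B t))"

text \<open>
  Widths are integers bounded below by \<open>-1\<close>, so each infimum is a minimum whenever a decomposition
  of the respective kind exists, and it is \<open>\<infinity>\<close> otherwise.
\<close>

definition tw :: "('a, 'b) pre_digraph \<Rightarrow> ereal" where
  "tw G = Inf {ereal (of_int (td_width T B)) | T B. tree_decomposition G T B}"

definition mtw :: "('a, 'b) pre_digraph \<Rightarrow> ereal" where
  "mtw G = Inf {ereal (of_int (td_width T B)) | T B. matched_tree_decomposition G T B}"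

text \<open>
  A graph with an isolated vertex has no matched tree decomposition, whereas every graph has a
  tree decomposition.
\<close>

lemma mtw_isolated:
  assumes v: "v \<in> verts G" and iso: "\<And>u. \<not> v \<rightarrow>\<^bsub>G\<^esub> u" and G: "graph G"
  shows "mtw G = \<infinity>"
proof -
  interpret graph G by fact
  have iso': "\<not> u \<rightarrow>\<^bsub>G\<^esub> v" for u
    using iso[of u] arcs_ends_symmetric[OF sym_arcs] by blast
  have "\<not> matched_tree_decomposition G T B" for T B
  proof
    assume D: "matched_tree_decomposition G T B"
    then have "Digraph_Component.connected (with_proj T \<restriction> {t \<in> pverts T. v \<in> B t})"
      using v by (auto simp: matched_tree_decomposition_def tree_decomposition_def)
    then have "{t \<in> pverts T. v \<in> B t} \<noteq> {}"
      by (auto simp: Digraph_Component.connected_def strongly_connected_def)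
    then obtain t where t: "t \<in> pverts T" "v \<in> B t" by blast
    have unc: "v \<notin> \<Union>M" if M: "matching (G \<restriction> B t) M" for M
    proof
      assume "v \<in> \<Union>M"
      then obtain a b where "v \<in> {a, b}" "a \<rightarrow>\<^bsub>G \<restriction> B t\<^esub> b"
        using M unfolding matching_def undirected_edges_def by blast
      then show False
        using iso iso' dominates_induce_subgraphD by (metis insertE singletonD)
    qed
    from D t(1) have "matched_bag G (B t)" by (auto simp: matched_tree_decomposition_def)
    then show False
      using unc t(2) iso unfolding matched_bag_def by (metis DiffI singletonD)
  qed
  then show ?thesis by (simp add: mtw_def top_ereal_def)
qed

lemma tw_finite:
  assumes "graph G"
  shows "tw G \<le> ereal (real (card (verts G)) - 1)"
proof -
  define T :: "nat pair_pre_digraph" where "T = \<lparr> pverts = {0}, parcs = {} \<rparr>"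
  have g: "graph (with_proj T)"
    by unfold_locales (auto simp: T_def symmetric_def sym_def)
  have c: "Digraph_Component.connected (with_proj T \<restriction> {0})"
    by (auto simp: Digraph_Component.connected_def strongly_connected_def T_def reachable_def
        intro: rtrancl_on_refl)
  then have c': "Digraph_Component.connected (with_proj T)"
    by (simp add: induce_subgraph_def T_def with_proj_def)
  interpret T: graph "with_proj T" by fact
  have "\<not> T.cycle p" for p
    by (cases p) (auto simp: T.cycle_def T.awalk_def, auto simp: T_def)
  then have "undirected_tree (with_proj T)"
    using g c' by (auto simp: undirected_tree_def)
  moreover interpret G: graph G by fact
  have "\<exists>t\<in>pverts T. u \<in> verts G \<and> v \<in> verts G" if "u \<rightarrow>\<^bsub>G\<^esub> v" for u v
    using that by (auto simp: T_def)
  ultimately have "tree_decomposition G T (\<lambda>_. verts G)"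
    using c by (auto simp: tree_decomposition_def T_def)
  moreover have "td_width T (\<lambda>_. verts G) = int (card (verts G)) - 1"
    by (simp add: td_width_def T_def)
  ultimately show ?thesis
    unfolding tw_def by (intro Inf_lower) force
qed

end

theory Submission
  imports Defs
begin

text \<open>
  Root a tree decomposition with bags of size at most \<open>K\<close> and walk down from the root, keeping a
  matching \<open>M\<close> of \<open>G\<close> whose edges all meet the current bag \<open>S\<close>, so that \<open>\<Union>M\<close> has at most \<open>2 |S|\<close>
  elements. When a vertex \<open>v\<close> of \<open>S\<close> is not covered, let \<open>X\<close> be the set of vertices of \<open>S\<close> to which the
  exposed vertex can be moved from \<open>v\<close> by alternating paths inside \<open>S\<close>. If some \<open>x\<close> in \<open>X\<close> has a
  neighbour in the subtree below \<open>S\<close> that is neither covered nor \<open>v\<close> itself, the matching can be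
  enlarged to cover \<open>v\<close>. Otherwise all neighbours of \<open>X\<close> in the subtree lie in the matched bag
  \<open>\<Union>M \<union> {v}\<close>, and those outside \<open>S\<close> are matched by \<open>M\<close> into \<open>X\<close>. Below this bag, \<open>X\<close> can be deleted
  and each of these neighbours put in place of its partner; no bag grows, and the descent continues
  in the smaller graph.
\<close>

section \<open>Matched rooted decompositions\<close>

text \<open>
  \<open>rooted_dec adj P n F S\<close>: the subgraph induced by \<open>F\<close> has a tree decomposition with \<open>n\<close> tree edges,
  all bags satisfying \<open>P\<close> and root bag \<open>S\<close>; gluing adds a tree edge between the two roots.
\<close>

inductive rooted_dec ::
  "('a \<Rightarrow> 'a \<Rightarrow> bool) \<Rightarrow> ('a set \<Rightarrow> bool) \<Rightarrow> nat \<Rightarrow> 'a set \<Rightarrow> 'a set \<Rightarrow> bool"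
  for adj P where
  single: "P S \<Longrightarrow> rooted_dec adj P 0 S S"
| glue: "\<lbrakk>rooted_dec adj P m F1 S1; rooted_dec adj P n F2 S2; F1 \<inter> F2 \<subseteq> S1 \<inter> S2;
      \<And>a b. \<lbrakk>adj a b; a \<in> F1; b \<in> F2\<rbrakk> \<Longrightarrow> a \<in> F2 \<or> b \<in> F1\<rbrakk>
    \<Longrightarrow> rooted_dec adj P (Suc (m + n)) (F1 \<union> F2) S1"

lemma rooted_dec_root_subset: "rooted_dec adj P n F S \<Longrightarrow> S \<subseteq> F"
  by (induction rule: rooted_dec.induct) auto

lemma rooted_dec_root: "rooted_dec adj P n F S \<Longrightarrow> P S"
  by (induction rule: rooted_dec.induct) auto

locale adjacency =
  fixes adj :: "'a \<Rightarrow> 'a \<Rightarrow> bool"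
  assumes adj_sym: "adj a b \<Longrightarrow> adj b a"
    and adj_irrefl: "\<not> adj a a"
begin

definition small :: "nat \<Rightarrow> 'a set \<Rightarrow> bool" where
  "small K S \<longleftrightarrow> finite S \<and> card S \<le> K"

definition edge_matching :: "'a set set \<Rightarrow> bool" where
  "edge_matching M \<longleftrightarrow> (\<forall>e\<in>M. \<exists>a b. adj a b \<and> e = {a, b}) \<and> pairwise disjnt M"

text \<open>The edges of \<open>M\<close> lie inside \<open>S\<close> because their union does, so
  \<open>M\<close> is a matching in the subgraph induced by \<open>S\<close>.\<close>

definition matched :: "'a set \<Rightarrow> bool" where
  "matched S \<longleftrightarrow> (\<exists>M. edge_matching M \<and> \<Union>M = S) \<or>
     (\<exists>M v. edge_matching M \<and> v \<notin> \<Union>M \<and> S = insert v (\<Union>M) \<and> (\<exists>u\<in>\<Union>M. adj v u))"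

text \<open>
  Replacing \<open>f z\<close> by its neighbour \<open>z\<close> in every bag keeps the occurrences of \<open>z\<close> connected, because
  the bags of \<open>z\<close> and of \<open>f z\<close> meet.
\<close>

lemma rooted_dec_exchange:
  assumes "rooted_dec adj (small K) n F S"
    and DX: "D \<inter> X = {}" and f: "inj_on f D" "\<And>z. z \<in> D \<Longrightarrow> f z \<in> X \<and> adj z (f z)"
    and "\<And>z b. \<lbrakk>z \<in> D - F; b \<in> F; adj z b\<rbrakk> \<Longrightarrow> b \<in> S"
  shows "rooted_dec adj (small K) n ((F - X) \<union> {z \<in> D. f z \<in> F}) ((S - X) \<union> {z \<in> D. f z \<in> S})"
  \<comment> \<open>For \<open>D \<subseteq> F\<close> the last premise is vacuous. It is there for
    the induction: a vertex of \<open>D\<close> may be missing from one side of a gluing, and then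
    its neighbours on that side lie in the root bag.\<close>
  using assms(1,5)
proof (induction rule: rooted_dec.induct)
  case (single S)
  have fin: "finite S" "card S \<le> K" using single by (auto simp: small_def)
  let ?D = "{z \<in> D. f z \<in> S}"
  have inj: "inj_on f ?D" using f(1) by (rule inj_on_subset) auto
  have sub: "f ` ?D \<subseteq> S \<inter> X" using f(2) by auto
  have finD: "finite ?D" using inj sub fin inj_on_finite by (metis finite_Int)
  \<comment> \<open>The map \<open>f\<close> injects the vertices put in into the vertices taken
    out, so the bag does not grow.\<close>
  have "card ?D \<le> card (S \<inter> X)" using card_inj_on_le[OF inj sub] fin by auto
  moreover have "card ((S - X) \<union> ?D) \<le> card (S - X) + card ?D" by (rule card_Un_le)
  moreover have "card (S - X) + card (S \<inter> X) = card S"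
    using fin by (metis Diff_Diff_Int Diff_subset add.commute card_Diff_subset card_mono finite_Diff le_add_diff_inverse2)
  ultimately show ?case using fin finD by (intro rooted_dec.single) (auto simp: small_def)
next
  case (glue m F1 S1 n F2 S2)
  let ?g = "\<lambda>A. (A - X) \<union> {z \<in> D. f z \<in> A}"
  have S: "S1 \<subseteq> F1" "S2 \<subseteq> F2" using glue.hyps rooted_dec_root_subset by blast+
  have cross: "a \<in> F2 \<or> b \<in> F1" if "adj a b" "a \<in> F1" "b \<in> F2" for a b
    using glue.hyps(4) that by blast
  have out: "b \<in> S1" if "z \<in> D" "z \<notin> F1" "z \<notin> F2" "b \<in> F1 \<union> F2" "adj z b" for z b
    using glue.prems that by blast
  have int: "F1 \<inter> F2 \<subseteq> S1 \<inter> S2" by fact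
  have 1: "rooted_dec adj (small K) m (?g F1) (?g S1)"
  proof (rule glue.IH(1))
    fix z b assume *: "z \<in> D - F1" "b \<in> F1" "adj z b"
    show "b \<in> S1"
      using * cross[of b z] out[of z b] adj_sym[of z b] int by blast
  qed
  have 2: "rooted_dec adj (small K) n (?g F2) (?g S2)"
  proof (rule glue.IH(2))
    fix z b assume *: "z \<in> D - F2" "b \<in> F2" "adj z b"
    show "b \<in> S2"
      using * cross[of z b] out[of z b] int S by blast
  qed
  have "?g F1 \<inter> ?g F2 \<subseteq> ?g S1 \<inter> ?g S2"
  proof
    fix y assume y: "y \<in> ?g F1 \<inter> ?g F2"
    have aj: "adj y (f y)" "adj (f y) y" if "y \<in> D" using f(2)[OF that] adj_sym by blast+
    \<comment> \<open>If \<open>y\<close> occurs itself on one side and in place of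
      \<open>f y\<close> on the other, the edge between \<open>y\<close> and \<open>f y\<close>
      crosses the gluing; so one of its ends lies on both sides, hence in both root bags.\<close>
    consider "y \<in> F1 - X" "y \<in> F2 - X" | "y \<in> F1 - X" "y \<in> D" "f y \<in> F2"
      | "y \<in> F2 - X" "y \<in> D" "f y \<in> F1" | "y \<in> D" "f y \<in> F1" "f y \<in> F2"
      using y by blast
    then show "y \<in> ?g S1 \<inter> ?g S2"
    proof cases
      case 2
      then show ?thesis using cross[of y "f y"] aj int by blast
    next
      case 3
      then show ?thesis using cross[of "f y" y] aj int by blast
    qed (use int in blast)+
  qed
  moreover have "a \<in> ?g F2 \<or> b \<in> ?g F1" if ab: "adj a b" "a \<in> ?g F1" "b \<in> ?g F2" for a b
  proof (rule ccontr)
    assume no: "\<not> ?thesis"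
    \<comment> \<open>A vertex of \<open>D\<close> outside both sides has its neighbours in
      \<open>F1 \<union> F2\<close> only in \<open>S1\<close>, a subset of \<open>F1\<close>. Hence
      both ends of a violating edge are old vertices, which contradicts
      \<open>cross\<close>.\<close>
    have far: "f z \<in> F1" if "z \<in> D" "z \<notin> F1" "z \<notin> F2" "f z \<in> F1 \<union> F2" for z
      using out[of z "f z"] f(2) that S by blast
    have b: "b \<in> F2 - X"
      using no ab far[of b] DX by blast
    have a: "a \<in> F1 - X"
    proof (rule ccontr)
      assume "a \<notin> F1 - X"
      then have "a \<in> D" "a \<notin> F1" "a \<notin> F2" using ab no DX by blast+
      then have "b \<in> S1" using out[of a b] b ab by blast
      then show False using no b S by blast
    qed
    show False using cross[of a b] ab a b no by blast
  qed
  ultimately have "rooted_dec adj (small K) (Suc (m + n)) (?g F1 \<union> ?g F2) (?g S1)"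
    using rooted_dec.glue[OF 1 2] by blast
  moreover have "?g F1 \<union> ?g F2 = ?g (F1 \<union> F2)" by blast
  ultimately show ?case by simp
qed

section \<open>Matchings\<close>

lemma edge_matching_same:
  "\<lbrakk>edge_matching M; e \<in> M; e' \<in> M; x \<in> e; x \<in> e'\<rbrakk> \<Longrightarrow> e = e'"
  unfolding edge_matching_def pairwise_def disjnt_def by blast

lemma edge_matching_subset: "edge_matching M \<Longrightarrow> M' \<subseteq> M \<Longrightarrow> edge_matching M'"
  unfolding edge_matching_def by (meson pairwise_subset subsetD)

lemma edge_matching_insert:
  assumes "edge_matching M" "adj a b" "a \<notin> \<Union>M" "b \<notin> \<Union>M"
  shows "edge_matching (insert {a, b} M)"
proof -
  have "disjnt {a, b} e \<and> disjnt e {a, b}" if "e \<in> M" for e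
    using that assms(3,4) by (auto simp: disjnt_def)
  then show ?thesis using assms(1,2) unfolding edge_matching_def pairwise_insert by blast
qed

lemma edge_matching_partner:
  assumes "edge_matching M" "e \<in> M" "x \<in> e"
  obtains y where "e = {x, y}" "adj x y" "x \<noteq> y"
proof -
  obtain a b where ab: "adj a b" "e = {a, b}" using assms(1,2) unfolding edge_matching_def by blast
  show ?thesis
  proof (cases "x = a")
    case True
    then show ?thesis using that[of b] ab adj_irrefl by auto
  next
    case False
    then show ?thesis using that[of a] ab adj_sym adj_irrefl assms(3) by auto
  qed
qed

text \<open>Each edge picks one of its ends in \<open>S\<close>, and disjoint edges pick distinct
  ends. So there are at most as many edges as covered vertices of \<open>S\<close>, and each edge
  covers two vertices; this is the source of the factor 2 in the width bound.\<close>

lemma edge_matching_card: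
  assumes M: "edge_matching M" and S: "finite S" "\<And>e. e \<in> M \<Longrightarrow> e \<inter> S \<noteq> {}"
  shows "finite (\<Union>M) \<and> card (\<Union>M) \<le> 2 * card (S \<inter> \<Union>M)"
proof -
  have "\<forall>e\<in>M. \<exists>x. x \<in> e \<inter> S" using S(2) by blast
  then obtain g where g: "\<And>e. e \<in> M \<Longrightarrow> g e \<in> e \<inter> S" by metis
  have inj: "inj_on g M" 
  proof (rule inj_onI)
    fix d e assume "d \<in> M" "e \<in> M" "g d = g e"
    then show "d = e" using g[of d] g[of e] edge_matching_same[OF M, of d e "g d"] by auto
  qed
  have img: "g ` M \<subseteq> S \<inter> \<Union>M" using g by blast
  have fin: "finite M" using inj img S(1) by (meson finite_Int inj_on_finite)
  have e2: "finite e \<and> card e \<le> 2" if e: "e \<in> M" for e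
  proof -
    obtain a b where "e = {a, b}" using M e unfolding edge_matching_def by blast
    then show ?thesis by (simp add: card_insert_if)
  qed
  have "card (\<Union>M) \<le> (\<Sum>e\<in>M. card e)" using e2 by (intro card_Union_le_sum_card)
  also have "\<dots> \<le> card M * 2" using e2 sum_bounded_above[of M card 2] by simp
  also have "card M \<le> card (S \<inter> \<Union>M)" using card_inj_on_le[OF inj img] S(1) by simp
  finally show ?thesis using fin e2 by auto
qed

text \<open>
  Rotations move the exposed vertex along alternating paths, but only within the bag \<open>S\<close>; hence every
  matching edge keeps meeting \<open>S\<close>.
\<close>

inductive rotation :: "'a set \<Rightarrow> 'a set set \<Rightarrow> 'a \<Rightarrow> 'a set set \<Rightarrow> 'a \<Rightarrow> bool" for S M v where
  init: "rotation S M v M v"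
| rotate: "\<lbrakk>rotation S M v N u; adj u z; {z, w} \<in> N; w \<in> S\<rbrakk>
    \<Longrightarrow> rotation S M v (insert {u, z} (N - {{z, w}})) w"

text \<open>A rotation trades the edge \<open>z w\<close> for \<open>u z\<close>, so the covered set
  together with the exposed vertex stays the same, and the new edge meets \<open>S\<close> in
  \<open>u\<close>. The last clause holds because an edge is only lost at the moment one of its ends
  becomes exposed.\<close>

lemma rotation_invariants:
  assumes "rotation S M v N u" "edge_matching M" "v \<in> S" "v \<notin> \<Union>M" "\<And>e. e \<in> M \<Longrightarrow> e \<inter> S \<noteq> {}"
  shows "edge_matching N \<and> u \<in> S \<and> u \<notin> \<Union>N \<and> insert u (\<Union>N) = insert v (\<Union>M) \<and>
    (\<forall>e\<in>N. e \<inter> S \<noteq> {}) \<and> (\<forall>e\<in>M. e \<in> N \<or> (\<exists>x\<in>e. \<exists>N'. rotation S M v N' x))"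
  using assms
proof (induction rule: rotation.induct)
  case init
  then show ?case by auto
next
  case (rotate N u z w)
  then have N: "edge_matching N" and u: "u \<in> S" "u \<notin> \<Union>N" and uN: "insert u (\<Union>N) = insert v (\<Union>M)"
    and NS: "\<forall>e\<in>N. e \<inter> S \<noteq> {}" and MN: "\<forall>e\<in>M. e \<in> N \<or> (\<exists>x\<in>e. \<exists>N'. rotation S M v N' x)"
    by auto
  let ?N = "insert {u, z} (N - {{z, w}})"
  have zw: "z \<noteq> w"
    using edge_matching_partner[OF N \<open>{z, w} \<in> N\<close>, of z] by (metis insertI1 insert_absorb2 singletonD insertI2)
  have uzw: "u \<noteq> w" "u \<noteq> z" using u \<open>{z, w} \<in> N\<close> by auto
  have others: "z \<notin> e \<and> w \<notin> e \<and> u \<notin> e" if "e \<in> N - {{z, w}}" for e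
    using that edge_matching_same[OF N, of e "{z, w}"] \<open>{z, w} \<in> N\<close> u by blast
  have "edge_matching ?N"
  proof (rule edge_matching_insert)
    show "edge_matching (N - {{z, w}})" using N by (rule edge_matching_subset) blast
  qed (use \<open>adj u z\<close> others in auto)
  moreover have "\<Union>N = {z, w} \<union> \<Union>(N - {{z, w}})" using \<open>{z, w} \<in> N\<close> by blast
  then have "insert w (\<Union>?N) = insert u (\<Union>N)" by auto
  moreover have "w \<notin> \<Union>?N" using others zw uzw by auto
  moreover have "rotation S M v ?N w" using rotate.hyps by (rule rotation.rotate)
  then have "\<forall>e\<in>M. e \<in> ?N \<or> (\<exists>x\<in>e. \<exists>N'. rotation S M v N' x)" using MN by blast
  ultimately show ?case using u NS uN \<open>w \<in> S\<close> by auto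
qed

section \<open>Matched bags and the descent through a rooted decomposition\<close>

lemma matched_single:
  assumes "edge_matching M" "finite S" "card S \<le> K" "\<And>e. e \<in> M \<Longrightarrow> e \<inter> S \<noteq> {}"
  shows "rooted_dec adj (\<lambda>S. small (2 * K) S \<and> matched S) 0 (\<Union>M) (\<Union>M)"
proof -
  have "finite (\<Union>M)" "card (\<Union>M) \<le> 2 * card (S \<inter> \<Union>M)"
    using edge_matching_card[OF assms(1,2,4)] by auto
  moreover have "card (S \<inter> \<Union>M) \<le> card S" using assms(2) by (simp add: card_mono)
  ultimately show ?thesis using assms
    by (intro rooted_dec.single) (auto simp: small_def matched_def)
qed

text \<open>Since \<open>v\<close> is exposed, at most \<open>K - 1\<close> vertices of
  \<open>S\<close> are covered, so the bag has at most \<open>2 * (K - 1) + 1\<close>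
  vertices.\<close>

lemma matched_single_insert:
  assumes "edge_matching M" "finite S" "card S \<le> K" "\<And>e. e \<in> M \<Longrightarrow> e \<inter> S \<noteq> {}"
    and "v \<in> S" "v \<notin> \<Union>M" "u \<in> \<Union>M" "adj v u"
  shows "rooted_dec adj (\<lambda>S. small (2 * K) S \<and> matched S) 0 (insert v (\<Union>M)) (insert v (\<Union>M))"
proof -
  have "finite (\<Union>M)" "card (\<Union>M) \<le> 2 * card (S \<inter> \<Union>M)"
    using edge_matching_card[OF assms(1,2,4)] by auto
  moreover have "card (S \<inter> \<Union>M) < card S"
    using assms(2,5,6) by (intro psubset_card_mono) auto
  ultimately have "small (2 * K) (insert v (\<Union>M))"
    using assms(3,6) by (simp add: small_def card_insert_if)
  moreover have "matched (insert v (\<Union>M))" 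
    unfolding matched_def using assms(1,6-8)
    by (intro disjI2 exI[of _ M] exI[of _ v] conjI bexI[of _ u]) auto
  ultimately show ?thesis by (intro rooted_dec.single conjI)
qed

text \<open>
  \<open>M\<close> is the part of the parent's matching that survives in the current bag; \<open>\<Union>M\<close> may contain vertices
  outside \<open>F\<close> that belong to earlier bags only.
\<close>

lemma matched_rooted_dec:
  assumes "rooted_dec adj (small K) n F S"
    and "edge_matching M" "\<And>e. e \<in> M \<Longrightarrow> e \<inter> S \<noteq> {}"
    and "\<And>w u. \<lbrakk>w \<in> F; w \<notin> S \<inter> \<Union>M; adj w u\<rbrakk> \<Longrightarrow> u \<in> F"
    and "\<And>w. w \<in> F \<Longrightarrow> \<exists>u. adj w u"
  shows "\<exists>m Q. rooted_dec adj (\<lambda>S. small (2 * K) S \<and> matched S) m (F \<union> \<Union>M) Q \<and> \<Union>M \<subseteq> Q"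
  using assms
\<comment> \<open>Lexicographic: splitting at a gluing lowers \<open>n\<close>; augmenting
  \<open>M\<close> or deleting \<open>X\<close> keeps \<open>n\<close> and lowers the number of
  uncovered vertices in the root bag.\<close>
proof (induction "(n, card (S - \<Union>M))" arbitrary: n F S M
    rule: wf_induct_rule[OF wf_lex_prod[OF wf_less_than wf_less_than]])
  case 1
  note dec = \<open>rooted_dec adj (small K) n F S\<close> and M = \<open>edge_matching M\<close>
    and MS = \<open>\<And>e. e \<in> M \<Longrightarrow> e \<inter> S \<noteq> {}\<close>
  \<comment> \<open>Only covered vertices of the root bag may have neighbours that were left behind
    outside \<open>F\<close>. In particular all neighbours of an exposed vertex of \<open>S\<close>
    are still present.\<close>
  have inner: "\<And>w u. \<lbrakk>w \<in> F; w \<notin> S \<inter> \<Union>M; adj w u\<rbrakk> \<Longrightarrow> u \<in> F"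
    and iso: "\<And>w. w \<in> F \<Longrightarrow> \<exists>u. adj w u" by fact+
  have IH: "\<exists>m Q. rooted_dec adj (\<lambda>S. small (2 * K) S \<and> matched S) m (F' \<union> \<Union>M') Q \<and> \<Union>M' \<subseteq> Q"
    if "n' < n \<or> n' = n \<and> card (S' - \<Union>M') < card (S - \<Union>M)"
      "rooted_dec adj (small K) n' F' S'" "edge_matching M'" "\<And>e. e \<in> M' \<Longrightarrow> e \<inter> S' \<noteq> {}"
      "\<And>w u. \<lbrakk>w \<in> F'; w \<notin> S' \<inter> \<Union>M'; adj w u\<rbrakk> \<Longrightarrow> u \<in> F'" "\<And>w. w \<in> F' \<Longrightarrow> w \<in> F"
    for n' F' S' M'
    using that iso by (intro "1.hyps"[of n' S' M' F']) auto
  have SF: "S \<subseteq> F" and S: "finite S" "card S \<le> K"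
    using rooted_dec_root_subset[OF dec] rooted_dec_root[OF dec] by (auto simp: small_def)
  show ?case
  proof (cases "S \<subseteq> \<Union>M")
    case True
    show ?thesis using dec
    proof cases
      case single
      then have "F \<union> \<Union>M = \<Union>M" using True by blast
      then show ?thesis using matched_single[OF M S MS] by auto
    next
      case (glue m1 F1 n2 F2 S2)
      have cross: "a \<in> F2 \<or> b \<in> F1" if "adj a b" "a \<in> F1" "b \<in> F2" for a b
        using glue that by blast
      have int: "F1 \<inter> F2 \<subseteq> S \<inter> S2" and FF: "F = F1 \<union> F2" by fact+
      have S': "S \<subseteq> F1" "S2 \<subseteq> F2" using glue rooted_dec_root_subset by blast+
      \<comment> \<open>The side with root \<open>S\<close> inherits all of \<open>M\<close>; the
        other side inherits only the edges that meet its own root bag, as the induction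
        requires.\<close>
      let ?M = "{e \<in> M. e \<inter> S2 \<noteq> {}}"
      have "\<exists>m Q. rooted_dec adj (\<lambda>S. small (2 * K) S \<and> matched S) m (F1 \<union> \<Union>M) Q \<and> \<Union>M \<subseteq> Q"
      proof (rule IH[of m1])
        fix w u assume w: "w \<in> F1" "w \<notin> S \<inter> \<Union>M" "adj w u"
        then show "u \<in> F1" using inner[of w u] True FF cross[of w u] int by blast
      qed (use glue M MS in auto)
      then obtain m1' Q1 where 1: "\<Union>M \<subseteq> Q1"
        "rooted_dec adj (\<lambda>S. small (2 * K) S \<and> matched S) m1' (F1 \<union> \<Union>M) Q1" by blast
      have "\<exists>m Q. rooted_dec adj (\<lambda>S. small (2 * K) S \<and> matched S) m (F2 \<union> \<Union>?M) Q \<and> \<Union>?M \<subseteq> Q"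
      proof (rule IH[of n2])
        fix w u assume w: "w \<in> F2" "w \<notin> S2 \<inter> \<Union>?M" "adj w u"
        have "w \<notin> F1"
        proof
          assume "w \<in> F1"
          then have "w \<in> S" "w \<in> S2" using w int by blast+
          then show False using w True by blast
        qed
        moreover have "w \<notin> S" using \<open>w \<notin> F1\<close> S' by blast
        ultimately show "u \<in> F2" using inner[of w u] w FF cross[of u w] adj_sym[of w u] by blast
      qed (use glue edge_matching_subset[OF M, of ?M] in auto)
      then obtain n2' Q2 where 2: "\<Union>?M \<subseteq> Q2"
        "rooted_dec adj (\<lambda>S. small (2 * K) S \<and> matched S) n2' (F2 \<union> \<Union>?M) Q2" by blast
      \<comment> \<open>Either \<open>p\<close> itself lies in \<open>S2\<close>, or its partner
        lies in \<open>S\<close> and the matching edge crosses the gluing, which puts the partner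
        into \<open>S2\<close>.\<close>
      have MF2: "p \<in> \<Union>?M" if p: "p \<in> \<Union>M" "p \<in> F2" for p
      proof (cases "p \<in> S")
        case True
        then show ?thesis using p int S' by blast
      next
        case False
        obtain e where e: "e \<in> M" "p \<in> e" using p by blast
        obtain w where w: "e = {p, w}" "adj p w" using edge_matching_partner[OF M e] by metis
        have "w \<in> S" using MS[OF e(1)] w False by blast
        moreover have "w \<in> S2"
          using cross[of w p] w adj_sym[of p w] \<open>w \<in> S\<close> S' p int False by blast
        ultimately show ?thesis using e w by blast
      qed
      have "(F1 \<union> \<Union>M) \<inter> (F2 \<union> \<Union>?M) \<subseteq> Q1 \<inter> Q2"
      proof
        fix p assume p: "p \<in> (F1 \<union> \<Union>M) \<inter> (F2 \<union> \<Union>?M)"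
        have "p \<in> \<Union>?M"
        proof (cases "p \<in> F2 \<and> p \<in> F1")
          case True
          then show ?thesis using int \<open>S \<subseteq> \<Union>M\<close> by blast
        qed (use p MF2 in blast)
        then show "p \<in> Q1 \<inter> Q2" using 1 2 by blast
      qed
      moreover have "a \<in> F2 \<union> \<Union>?M \<or> b \<in> F1 \<union> \<Union>M"
        if ab: "adj a b" "a \<in> F1 \<union> \<Union>M" "b \<in> F2 \<union> \<Union>?M" for a b
      proof (rule ccontr)
        assume no: "\<not> ?thesis"
        then have b: "b \<in> F2" "b \<notin> F1" "b \<notin> S" using ab S' by blast+
        then have "a \<in> F" using inner[of b a] ab adj_sym[of a b] FF by blast
        then have "a \<in> F1" using FF no by blast
        then show False using cross[of a b] ab b no by blast
      qed
      ultimately have "rooted_dec adj (\<lambda>S. small (2 * K) S \<and> matched S) (Suc (m1' + n2'))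
          ((F1 \<union> \<Union>M) \<union> (F2 \<union> \<Union>?M)) Q1"
        by (rule rooted_dec.glue[OF 1(2) 2(2)])
      moreover have "(F1 \<union> \<Union>M) \<union> (F2 \<union> \<Union>?M) = F \<union> \<Union>M" using FF by blast
      ultimately show ?thesis using 1(1) by (intro exI[of _ "Suc (m1' + n2')"] exI[of _ Q1]) auto
    qed
  next
    case False
    then obtain v where v: "v \<in> S" "v \<notin> \<Union>M" by blast
    note inv = rotation_invariants[OF _ M v MS]
    have cardlt: "card (A - B) < card (S - \<Union>M)" if "A - B \<subseteq> S - \<Union>M" "v \<notin> A - B" for A B
      using that v S by (intro psubset_card_mono) auto
    show ?thesis
    \<comment> \<open>Augmentation: after moving the exposed vertex from \<open>v\<close> to
      \<open>u\<close>, the edge \<open>u p\<close> can be added. Then \<open>v\<close> and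
      \<open>p\<close> are covered as well, and nothing becomes uncovered.\<close>
    proof (cases "\<exists>N u p. rotation S M v N u \<and> p \<in> F \<and> adj u p \<and> p \<notin> insert v (\<Union>M)")
      case True
      then obtain N u p where r: "rotation S M v N u" and p: "p \<in> F" "adj u p" "p \<notin> insert v (\<Union>M)"
        by blast
      let ?N = "insert {u, p} N"
      have N: "edge_matching N" "u \<in> S" "u \<notin> \<Union>N" and uN: "insert u (\<Union>N) = insert v (\<Union>M)"
        and NS: "\<forall>e\<in>N. e \<inter> S \<noteq> {}" using inv[OF r] by auto
      have pN: "p \<notin> \<Union>N" using p uN by blast
      have cover: "\<Union>?N = insert p (insert v (\<Union>M))" using uN by auto
      have "\<exists>m Q. rooted_dec adj (\<lambda>S. small (2 * K) S \<and> matched S) m (F \<union> \<Union>?N) Q \<and> \<Union>?N \<subseteq> Q"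
      proof (rule IH[OF _ dec])
        show "n < n \<or> n = n \<and> card (S - \<Union>?N) < card (S - \<Union>M)"
          unfolding cover using cardlt[of S "insert p (insert v (\<Union>M))"] by auto
        show "edge_matching ?N"
          using edge_matching_insert[OF N(1) p(2) N(3) pN] .
        show "e \<inter> S \<noteq> {}" if "e \<in> ?N" for e using that N NS by blast
        show "u \<in> F" if "w \<in> F" "w \<notin> S \<inter> \<Union>?N" "adj w u" for w u
          using inner[of w u] that unfolding cover by blast
      qed
      then obtain m Q where "rooted_dec adj (\<lambda>S. small (2 * K) S \<and> matched S) m (F \<union> \<Union>?N) Q"
        "\<Union>?N \<subseteq> Q" by blast
      moreover have "F \<union> \<Union>?N = F \<union> \<Union>M" unfolding cover using p v SF by blast
      moreover have "\<Union>M \<subseteq> \<Union>?N" unfolding cover by blast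
      ultimately show ?thesis by (intro exI[of _ m] exI[of _ Q]) auto
    next
      case False
      define X where "X = {u. \<exists>N. rotation S M v N u}"
      define D where "D = {z \<in> F - S. \<exists>x\<in>X. adj x z}"
      have XN: "p \<in> insert v (\<Union>M)" if "x \<in> X" "adj x p" "p \<in> F" for x p
        using False that unfolding X_def by blast
      have vX: "v \<in> X" unfolding X_def using rotation.init by blast
      have XS: "X \<subseteq> S" unfolding X_def using inv by blast
      have XQ: "X \<subseteq> insert v (\<Union>M)" unfolding X_def using inv by blast
      have partner: "\<exists>s. s \<in> X \<and> adj z s \<and> {z, s} \<in> M" if z: "z \<in> D" for z
      proof -
        obtain N u where r: "rotation S M v N u" and u: "adj u z" "u \<in> X"
          using z unfolding D_def X_def by blast
        have zF: "z \<in> F" "z \<notin> S" using z unfolding D_def by auto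
        then have "z \<in> \<Union>M" using XN[of u z] u v by blast
        then obtain e where e: "e \<in> M" "z \<in> e" by blast
        obtain s where s: "e = {z, s}" "adj z s" using edge_matching_partner[OF M e] by metis
        have sS: "s \<in> S" using MS[OF e(1)] s zF by blast
        have "s \<in> X"
        \<comment> \<open>If the edge \<open>z s\<close> survives in \<open>N\<close>, one more
          rotation, from \<open>u\<close> over \<open>z\<close>, exposes \<open>s\<close>. If it was
          lost, one of its ends had been exposed; exposed vertices lie in \<open>S\<close> and
          \<open>z\<close> does not, so it was \<open>s\<close>.\<close>
        proof (cases "e \<in> N")
          case True
          then show ?thesis using rotation.rotate[OF r u(1)] s sS unfolding X_def by blast
        next
          case False
          then have "\<exists>x\<in>e. x \<in> X" using inv[OF r] e unfolding X_def by blast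
          then show ?thesis using s XS zF by blast
        qed
        then show ?thesis using s e by blast
      qed
      then obtain f where f: "\<And>z. z \<in> D \<Longrightarrow> f z \<in> X \<and> adj z (f z) \<and> {z, f z} \<in> M" by metis
      have inj: "inj_on f D"
      proof (rule inj_onI)
        fix y z assume *: "y \<in> D" "z \<in> D" "f y = f z"
        then have "{y, f y} = {z, f z}"
          using f[of y] f[of z] edge_matching_same[OF M, of "{y, f y}" "{z, f z}" "f y"] by auto
        moreover have "y \<noteq> f z" using * f XS unfolding D_def by blast
        ultimately show "y = z" by blast
      qed
      let ?F = "F - X" and ?S = "(S - X) \<union> D"
      have DF: "D \<subseteq> F - X" using XS unfolding D_def by blast
      \<comment> \<open>As \<open>D\<close> already lies in \<open>F - X\<close>, the exchange
        removes \<open>X\<close> and adds no vertex to the graph. All of \<open>D\<close> enters the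
        root bag, because its partners lie in \<open>X \<subseteq> S\<close>.\<close>
      have "rooted_dec adj (small K) n ((F - X) \<union> {z \<in> D. f z \<in> F}) ((S - X) \<union> {z \<in> D. f z \<in> S})"
        by (rule rooted_dec_exchange[OF dec _ inj]) (use f DF in blast)+
      moreover have "(F - X) \<union> {z \<in> D. f z \<in> F} = ?F" "{z \<in> D. f z \<in> S} = D"
        using DF f XS by blast+
      ultimately have dec': "rooted_dec adj (small K) n ?F ?S" by simp
      let ?M = "{e \<in> M. e \<inter> ?S \<noteq> {}}"
      have DM: "D \<subseteq> \<Union>M" using f by blast
      \<comment> \<open>Neighbours of deleted vertices are covered and lie in the new root bag, so
        \<open>inner\<close> is preserved for the smaller graph.\<close>
      have ZS: "w \<in> ?S \<inter> \<Union>?M" if "w \<in> F - X" "x \<in> X" "adj w x" for w x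
      proof -
        have "w \<in> \<Union>M" using XN[of x w] that adj_sym[of w x] vX by blast
        moreover have "w \<in> ?S" using that adj_sym[of w x] unfolding D_def by blast
        ultimately show ?thesis by blast
      qed
      have "\<exists>m Q. rooted_dec adj (\<lambda>S. small (2 * K) S \<and> matched S) m (?F \<union> \<Union>?M) Q \<and> \<Union>?M \<subseteq> Q"
      proof (rule IH[OF _ dec'])
        \<comment> \<open>The vertices of \<open>D\<close> are covered, and a covered vertex of the
          new root bag keeps its edge; so no uncovered vertex arises, and \<open>v\<close>
          disappears with \<open>X\<close>.\<close>
        have "?S - \<Union>?M \<subseteq> S - \<Union>M" using DM by blast
        then show "n < n \<or> n = n \<and> card (?S - \<Union>?M) < card (S - \<Union>M)"
          using cardlt[of ?S "\<Union>?M"] vX DF by blast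
        show "edge_matching ?M" using M by (rule edge_matching_subset) blast
        show "u \<in> ?F" if w: "w \<in> ?F" "w \<notin> ?S \<inter> \<Union>?M" "adj w u" for w u
        proof -
          have "u \<notin> X" using ZS[of w u] w by blast
          moreover have "w \<notin> S \<inter> \<Union>M" using w by blast
          ultimately show ?thesis using inner[of w u] w by blast
        qed
      qed auto
      then obtain m Q where mQ: "\<Union>?M \<subseteq> Q"
        "rooted_dec adj (\<lambda>S. small (2 * K) S \<and> matched S) m (?F \<union> \<Union>?M) Q" by blast
      let ?Q = "insert v (\<Union>M)"
      \<comment> \<open>The neighbour of \<open>v\<close> exists because \<open>v\<close> is not
        isolated, and it is covered because augmentation fails. This makes \<open>\<Union>M\<close>
        with the single exposed vertex \<open>v\<close> a matched bag.\<close>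
      obtain u where u: "adj v u" "u \<in> F" using iso[of v] inner[of v] v SF by blast
      then have "u \<in> \<Union>M" using XN[of v u] vX adj_irrefl by blast
      then have Q: "rooted_dec adj (\<lambda>S. small (2 * K) S \<and> matched S) 0 ?Q ?Q"
        using matched_single_insert[OF M S MS v] u by blast
      \<comment> \<open>If the partner of \<open>q\<close> is deleted, \<open>q\<close> lies in the
        new root bag by \<open>ZS\<close>. Otherwise the edge of \<open>q\<close> meets
        \<open>S\<close> in a vertex that survives.\<close>
      have QF: "q \<in> \<Union>?M" if q: "q \<in> ?Q" "q \<in> ?F" for q
      proof -
        have "q \<in> \<Union>M" using q vX by blast
        then obtain e where e: "e \<in> M" "q \<in> e" by blast
        obtain s where s: "e = {q, s}" "adj q s" using edge_matching_partner[OF M e] by metis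
        show ?thesis
        proof (cases "s \<in> X")
          case True
          then show ?thesis using ZS[of q s] q s by blast
        next
          case False
          then have "e \<inter> (S - X) \<noteq> {}" using MS[OF e(1)] s q by blast
          then show ?thesis using e by blast
        qed
      qed
      have "?Q \<inter> (?F \<union> \<Union>?M) \<subseteq> ?Q \<inter> Q" using QF mQ by blast
      moreover have "a \<in> ?F \<union> \<Union>?M \<or> b \<in> ?Q"
        if ab: "adj a b" "a \<in> ?Q" "b \<in> ?F \<union> \<Union>?M" for a b
      proof (rule ccontr)
        assume no: "\<not> ?thesis"
        then have b: "b \<in> F - X" "b \<notin> \<Union>M" using ab by blast+
        then have "a \<in> F" using inner[of b a] ab adj_sym[of a b] by blast
        then have "a \<in> X" using no by blast
        then show False using XN[of a b] b ab no by blast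
      qed
      ultimately have "rooted_dec adj (\<lambda>S. small (2 * K) S \<and> matched S) (Suc (0 + m))
          (?Q \<union> (?F \<union> \<Union>?M)) ?Q"
        by (rule rooted_dec.glue[OF Q mQ(2)])
      \<comment> \<open>The deleted set \<open>X\<close> is contained in the new bag
        \<open>?Q\<close>, so no vertex is lost.\<close>
      moreover have "?Q \<union> (?F \<union> \<Union>?M) = F \<union> \<Union>M" using XQ v SF by blast
      ultimately show ?thesis by (intro exI[of _ "Suc (0 + m)"] exI[of _ ?Q]) auto
    qed
  qed
qed

end

section \<open>Rooted decompositions and trees\<close>

text \<open>The empty set counts as connected, which covers the vertices that occur in no bag of a
  subtree.\<close>

definition conn_on :: "'n rel \<Rightarrow> 'n set \<Rightarrow> bool" where
  "conn_on E A \<longleftrightarrow> (\<forall>x\<in>A. \<forall>y\<in>A. (x, y) \<in> (E \<inter> A \<times> A)\<^sup>*)"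

text \<open>Acyclicity, phrased as: every edge is a bridge.\<close>

definition bridged :: "'n rel \<Rightarrow> bool" where
  "bridged E \<longleftrightarrow> (\<forall>a b. (a, b) \<in> E \<longrightarrow> (a, b) \<notin> (E - {(a, b), (b, a)})\<^sup>*)"

text \<open>The relation \<open>E\<close> may have edges outside \<open>A\<close>, and only graph
  edges between vertices occurring in the bags are considered; so the same \<open>E\<close> and
  \<open>B\<close> serve for every subtree.\<close>

definition tree_dec ::
  "('a \<Rightarrow> 'a \<Rightarrow> bool) \<Rightarrow> ('a set \<Rightarrow> bool) \<Rightarrow> 'n set \<Rightarrow> 'n rel \<Rightarrow> ('n \<Rightarrow> 'a set) \<Rightarrow> bool" where
  "tree_dec adj P A E B \<longleftrightarrow> finite A \<and> sym E \<and> bridged E \<and> conn_on E A \<and>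
     (\<forall>v. conn_on E {t \<in> A. v \<in> B t}) \<and> (\<forall>t\<in>A. P (B t)) \<and>
     (\<forall>a b. adj a b \<longrightarrow> a \<in> \<Union>(B ` A) \<longrightarrow> b \<in> \<Union>(B ` A) \<longrightarrow> (\<exists>t\<in>A. a \<in> B t \<and> b \<in> B t))"

section \<open>Splitting a tree at an edge\<close>

text \<open>A walk inside \<open>C\<close> leaves \<open>A\<close> from \<open>r\<close> and, by
  symmetry, comes back to \<open>r\<close>. Its excursions outside \<open>A\<close> can therefore be
  cut out.\<close>

lemma conn_on_side:
  assumes C: "conn_on E C" and "sym E"
    and gate: "\<And>a b. \<lbrakk>(a, b) \<in> E; a \<in> C \<inter> A; b \<in> C - A\<rbrakk> \<Longrightarrow> a = r"
  shows "conn_on E (C \<inter> A)"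
  unfolding conn_on_def
proof (intro ballI)
  fix x y assume x: "x \<in> C \<inter> A" and y: "y \<in> C \<inter> A"
  let ?R = "E \<inter> (C \<inter> A) \<times> (C \<inter> A)"
  have "(w \<in> A \<longrightarrow> (x, w) \<in> ?R\<^sup>*) \<and> (w \<notin> A \<longrightarrow> (x, r) \<in> ?R\<^sup>*)"
    if "(x, w) \<in> (E \<inter> C \<times> C)\<^sup>*" for w
    using that
  proof induction
    case base
    then show ?case using x by auto
  next
    case (step w z)
    have wz: "(w, z) \<in> E" "(z, w) \<in> E" "w \<in> C" "z \<in> C"
      using step.hyps(2) \<open>sym E\<close> by (auto dest: symD)
    show ?case
    proof (cases "w \<in> A")
      case wA: True
      show ?thesis
      proof (cases "z \<in> A")
        case True
        then show ?thesis using wA step.IH wz by (auto intro: rtrancl_into_rtrancl)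
      next
        case False
        then show ?thesis using gate[of w z] wA step.IH wz by auto
      qed
    next
      case False
      then show ?thesis using gate[of z w] step.IH wz by auto
    qed
  qed
  then show "(x, y) \<in> ?R\<^sup>*" using C x y unfolding conn_on_def by blast
qed

lemma conn_on_crossing:
  assumes C: "conn_on E C" and x: "x \<in> C \<inter> A" and y: "y \<in> C - A"
  shows "\<exists>a\<in>C \<inter> A. \<exists>b\<in>C - A. (a, b) \<in> E"
proof (rule ccontr)
  assume no: "\<not> ?thesis"
  have "w \<in> A" if "(x, w) \<in> (E \<inter> C \<times> C)\<^sup>*" for w
    using that by induction (use x no in auto)
  then show False using C x y unfolding conn_on_def by blast
qed

text \<open>An edge from the root \<open>r\<close> to a neighbour \<open>s\<close> is a bridge, so
  removing it splits the tree into the parts \<open>A1\<close> and \<open>A2\<close> around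
  \<open>r\<close> and \<open>s\<close>. Their rooted decompositions are glued along this
  edge.\<close>

lemma rooted_dec_of_tree_dec:
  assumes "tree_dec adj P A E B" "r \<in> A"
  shows "\<exists>n. rooted_dec adj P n (\<Union>(B ` A)) (B r)"
  using assms
proof (induction "card A" arbitrary: A r rule: less_induct)
  case less
  have A: "finite A" and E: "sym E" "bridged E" and conn: "conn_on E A"
    and occ: "\<And>v. conn_on E {t \<in> A. v \<in> B t}" and P: "\<And>t. t \<in> A \<Longrightarrow> P (B t)"
    and edge: "\<And>a b. \<lbrakk>adj a b; a \<in> \<Union>(B ` A); b \<in> \<Union>(B ` A)\<rbrakk> \<Longrightarrow> \<exists>t\<in>A. a \<in> B t \<and> b \<in> B t"
    using less.prems(1) unfolding tree_dec_def by blast+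
  show ?case
  proof (cases "A = {r}")
    case True
    then show ?thesis using rooted_dec.single[of P "B r" adj] P by auto
  next
    case False
    then obtain y where y: "y \<in> A" "y \<noteq> r" using less.prems(2) by blast
    then have "(r, y) \<in> (E \<inter> A \<times> A)\<^sup>*" using conn less.prems(2) unfolding conn_on_def by blast
    then obtain s where s: "(r, s) \<in> E" "s \<in> A"
      using y by (auto elim: converse_rtranclE)
    define R where "R = (E \<inter> A \<times> A) - {(r, s), (s, r)}"
    define A1 where "A1 = {a \<in> A. (r, a) \<in> R\<^sup>*}"
    define A2 where "A2 = {a \<in> A. (s, a) \<in> R\<^sup>*}"
    have symR: "sym R" using \<open>sym E\<close> unfolding R_def sym_def by blast
    have rA: "r \<in> A1" "s \<in> A2" using s less.prems(2) unfolding A1_def A2_def by auto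
    have "a \<in> A1 \<union> A2" if a: "a \<in> A" for a
    proof -
      have "(r, a) \<in> (E \<inter> A \<times> A)\<^sup>*" using conn less.prems(2) a unfolding conn_on_def by blast
      then show ?thesis
      proof induction
        case base
        then show ?case using rA by blast
      next
        case (step b c)
        then show ?case
          using rA unfolding A1_def A2_def R_def
          by (cases "(b, c) \<in> {(r, s), (s, r)}") (auto intro: rtrancl_into_rtrancl)
      qed
    qed
    then have un: "A = A1 \<union> A2" unfolding A1_def A2_def by blast
    have disj: "A1 \<inter> A2 = {}"
    proof (rule ccontr)
      assume "A1 \<inter> A2 \<noteq> {}"
      then obtain a where "(r, a) \<in> R\<^sup>*" "(s, a) \<in> R\<^sup>*" unfolding A1_def A2_def by blast
      then have "(r, s) \<in> R\<^sup>*" using symR by (meson rtrancl_trans sym_rtrancl symD)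
      moreover have "R\<^sup>* \<subseteq> (E - {(r, s), (s, r)})\<^sup>*" by (rule rtrancl_mono) (auto simp: R_def)
      ultimately show False using s E(2) unfolding bridged_def by blast
    qed
    have cross: "a = r \<and> b = s" if ab: "(a, b) \<in> E" "a \<in> A1" "b \<in> A2" for a b
    proof (rule ccontr)
      assume "\<not> ?thesis"
      moreover have "(a, b) \<noteq> (s, r)" using ab disj rA by blast
      ultimately have "(a, b) \<in> R" using ab un unfolding R_def by auto
      then have "b \<in> A1" using ab un unfolding A1_def by (auto intro: rtrancl_into_rtrancl)
      then show False using ab disj by blast
    qed
    have side1: "conn_on E (C \<inter> A1)" if "conn_on E C" "C \<subseteq> A" for C
      using that(1) E(1) by (rule conn_on_side[of _ _ _ r]) (use that(2) cross un in blast)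
    have side2: "conn_on E (C \<inter> A2)" if "conn_on E C" "C \<subseteq> A" for C
      using that(1) E(1) by (rule conn_on_side[of _ _ _ s]) (use that(2) cross un E(1) symD in fast)
    \<comment> \<open>The nodes whose bags contain \<open>v\<close> are connected, and the only tree
      edge between the two parts joins \<open>r\<close> and \<open>s\<close>.\<close>
    have cut: "v \<in> B r \<and> v \<in> B s" if v: "a \<in> A1" "v \<in> B a" "b \<in> A2" "v \<in> B b" for a b v
    proof -
      have "\<exists>x\<in>{t \<in> A. v \<in> B t} \<inter> A1. \<exists>y\<in>{t \<in> A. v \<in> B t} - A1. (x, y) \<in> E"
        using occ by (rule conn_on_crossing[of _ _ a _ b]) (use v un disj in auto)
      then show ?thesis using cross un by blast
    qed
    have td1: "tree_dec adj P A1 E B"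
    proof -
      have "A1 = A \<inter> A1" "\<And>v. {t \<in> A1. v \<in> B t} = {t \<in> A. v \<in> B t} \<inter> A1" using un by auto
      then have "conn_on E A1" "\<And>v. conn_on E {t \<in> A1. v \<in> B t}"
        using side1[OF conn] side1[OF occ] by auto
      \<comment> \<open>If the bag containing both ends lies in the other part, \<open>cut\<close>
        puts both ends into \<open>B r\<close>.\<close>
      moreover have "\<exists>t\<in>A1. a \<in> B t \<and> b \<in> B t"
        if ab: "adj a b" "a \<in> \<Union>(B ` A1)" "b \<in> \<Union>(B ` A1)" for a b
      proof -
        obtain t where t: "t \<in> A" "a \<in> B t" "b \<in> B t" using edge[of a b] ab un by blast
        then show ?thesis using cut ab(2,3) rA un by blast
      qed
      ultimately show ?thesis using A E P un unfolding tree_dec_def by auto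
    qed
    have td2: "tree_dec adj P A2 E B"
    proof -
      have "A2 = A \<inter> A2" "\<And>v. {t \<in> A2. v \<in> B t} = {t \<in> A. v \<in> B t} \<inter> A2" using un by auto
      then have "conn_on E A2" "\<And>v. conn_on E {t \<in> A2. v \<in> B t}"
        using side2[OF conn] side2[OF occ] by auto
      moreover have "\<exists>t\<in>A2. a \<in> B t \<and> b \<in> B t"
        if ab: "adj a b" "a \<in> \<Union>(B ` A2)" "b \<in> \<Union>(B ` A2)" for a b
      proof -
        obtain t where t: "t \<in> A" "a \<in> B t" "b \<in> B t" using edge[of a b] ab un by blast
        then show ?thesis using cut ab(2,3) rA un by blast
      qed
      ultimately show ?thesis using A E P un unfolding tree_dec_def by auto
    qed
    have "A1 \<subset> A" "A2 \<subset> A" using un disj rA by blast+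
    then have "card A1 < card A" "card A2 < card A" using A psubset_card_mono by blast+
    then obtain m n where "rooted_dec adj P m (\<Union>(B ` A1)) (B r)"
      "rooted_dec adj P n (\<Union>(B ` A2)) (B s)"
      using less.hyps td1 td2 rA by meson
    moreover have "\<Union>(B ` A1) \<inter> \<Union>(B ` A2) \<subseteq> B r \<inter> B s" using cut by blast
    moreover have "a \<in> \<Union>(B ` A2) \<or> b \<in> \<Union>(B ` A1)"
      if "adj a b" "a \<in> \<Union>(B ` A1)" "b \<in> \<Union>(B ` A2)" for a b
      using edge[of a b] that un by blast
    ultimately have "rooted_dec adj P (Suc (m + n)) (\<Union>(B ` A1) \<union> \<Union>(B ` A2)) (B r)"
      by (rule rooted_dec.glue)
    moreover have "\<Union>(B ` A1) \<union> \<Union>(B ` A2) = \<Union>(B ` A)" using un by blast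
    ultimately show ?thesis by auto
  qed
qed

section \<open>Joining two trees by an edge\<close>

lemma conn_on_mono: "conn_on E A \<Longrightarrow> E \<subseteq> E' \<Longrightarrow> conn_on E' A"
  unfolding conn_on_def by (meson Int_mono order_refl rtrancl_mono subsetD)

lemma conn_on_Un:
  assumes "conn_on E C1" "conn_on E C2" "sym E"
    and link: "C1 \<noteq> {} \<Longrightarrow> C2 \<noteq> {} \<Longrightarrow> \<exists>a\<in>C1. \<exists>b\<in>C2. (a, b) \<in> E"
  shows "conn_on E (C1 \<union> C2)"
proof -
  let ?R = "E \<inter> (C1 \<union> C2) \<times> (C1 \<union> C2)"
  have sub: "(x, y) \<in> ?R\<^sup>*" if "x \<in> C1 \<and> y \<in> C1 \<or> x \<in> C2 \<and> y \<in> C2" for x y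
  proof -
    have "(x, y) \<in> (E \<inter> C1 \<times> C1)\<^sup>* \<or> (x, y) \<in> (E \<inter> C2 \<times> C2)\<^sup>*"
      using that assms(1,2) unfolding conn_on_def by blast
    moreover have "(E \<inter> C1 \<times> C1)\<^sup>* \<subseteq> ?R\<^sup>*" "(E \<inter> C2 \<times> C2)\<^sup>* \<subseteq> ?R\<^sup>*" by (intro rtrancl_mono; blast)+
    ultimately show ?thesis by blast
  qed
  have sym: "sym (?R\<^sup>*)" using assms(3) by (intro sym_rtrancl) (auto simp: sym_def)
  have "(x, y) \<in> ?R\<^sup>*" if xy: "x \<in> C1" "y \<in> C2" for x y
  proof -
    obtain a b where ab: "a \<in> C1" "b \<in> C2" "(a, b) \<in> E" using link xy by blast
    then have "(a, b) \<in> ?R" by blast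
    then show ?thesis
      using sub[of x a] sub[of b y] ab xy by (meson rtrancl_into_rtrancl rtrancl_trans)
  qed
  then show ?thesis using sub sym unfolding conn_on_def by (meson UnE symD)
qed

text \<open>A walk that leaves \<open>A2\<close> does so from \<open>r2\<close> and returns to
  \<open>r2\<close>. So a detour around an edge of \<open>E2\<close> in the joined tree would
  shorten to a detour within \<open>E2\<close>.\<close>

lemma bridged_join:
  assumes E1: "E1 \<subseteq> A1 \<times> A1" and E2: "E2 \<subseteq> A2 \<times> A2" "bridged E2" "A1 \<inter> A2 = {}"
    and r: "r1 \<in> A1" "r2 \<in> A2" and ab: "(a, b) \<in> E2"
  shows "(a, b) \<notin> (E1 \<union> E2 \<union> {(r1, r2), (r2, r1)} - {(a, b), (b, a)})\<^sup>*"
proof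
  let ?R = "E2 - {(a, b), (b, a)}"
  assume path: "(a, b) \<in> (E1 \<union> E2 \<union> {(r1, r2), (r2, r1)} - {(a, b), (b, a)})\<^sup>*"
  have "(w \<in> A2 \<longrightarrow> (a, w) \<in> ?R\<^sup>*) \<and> (w \<notin> A2 \<longrightarrow> (a, r2) \<in> ?R\<^sup>*)"
    if "(a, w) \<in> (E1 \<union> E2 \<union> {(r1, r2), (r2, r1)} - {(a, b), (b, a)})\<^sup>*" for w
    using that
  proof induction
    case base
    then show ?case using ab E2 by auto
  next
    case (step w z)
    then consider "(w, z) \<in> E1" | "(w, z) \<in> ?R" | "w = r1" "z = r2" | "w = r2" "z = r1" by blast
    then show ?case
      by cases (use step.IH E1 E2 r in \<open>auto intro: rtrancl_into_rtrancl\<close>)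
  qed
  then have "(a, b) \<in> ?R\<^sup>*" using path ab E2 by blast
  then show False using E2 ab unfolding bridged_def by blast
qed

text \<open>The bound \<open>N\<close> on the node names lets the two trees of a gluing step be chosen disjoint.\<close>

lemma (in adjacency) tree_dec_of_rooted_dec:
  assumes "rooted_dec adj P n F S"
  shows "\<exists>A E B r. A \<subseteq> {N..} \<and> E \<subseteq> A \<times> A \<and> irrefl E \<and> r \<in> A \<and> B r = S \<and> \<Union>(B ` A) = F \<and>
    tree_dec adj P A (E :: nat rel) B"
  using assms
proof (induction arbitrary: N rule: rooted_dec.induct)
  case (single S)
  have "tree_dec adj P {N} {} (\<lambda>_. S)"
    using single by (auto simp: tree_dec_def conn_on_def bridged_def sym_def)
  then show ?case
    by (intro exI[of _ "{N}"] exI[of _ "{}"] exI[of _ "\<lambda>_. S"] exI[of _ N]) (auto simp: irrefl_def)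
next
  case (glue m F1 S1 n F2 S2)
  obtain A1 E1 B1 r1 where 1: "A1 \<subseteq> {N..}" "E1 \<subseteq> A1 \<times> A1" "irrefl E1" "r1 \<in> A1" "B1 r1 = S1"
    "\<Union>(B1 ` A1) = F1" "tree_dec adj P A1 E1 B1"
    using glue.IH(1)[of N] by blast
  define L where "L = Suc (Max A1)"
  have finA1: "finite A1" using 1(7) unfolding tree_dec_def by blast
  obtain A2 E2 B2 r2 where 2: "A2 \<subseteq> {L..}" "E2 \<subseteq> A2 \<times> A2" "irrefl E2" "r2 \<in> A2" "B2 r2 = S2"
    "\<Union>(B2 ` A2) = F2" "tree_dec adj P A2 E2 B2"
    using glue.IH(2)[of L] by blast
  have A1L: "a < L" if "a \<in> A1" for a using that finA1 unfolding L_def by (simp add: le_imp_less_Suc)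
  then have disj: "A1 \<inter> A2 = {}" using 2(1) by fastforce
  have "N < L" using A1L[OF 1(4)] 1(1,4) by auto
  then have AN: "A1 \<union> A2 \<subseteq> {N..}" using 1(1) 2(1) by auto
  define E where "E = E1 \<union> E2 \<union> {(r1, r2), (r2, r1)}"
  define B where "B = (\<lambda>t. if t \<in> A1 then B1 t else B2 t)"
  have B: "\<And>t. t \<in> A1 \<Longrightarrow> B t = B1 t" "\<And>t. t \<in> A2 \<Longrightarrow> B t = B2 t"
    using disj unfolding B_def by auto
  have F: "\<Union>(B ` A1) = F1" "\<Union>(B ` A2) = F2" using B 1(6) 2(6) by simp_all
  have t1: "sym E1" "bridged E1" "conn_on E1 A1" "\<And>v. conn_on E1 {t \<in> A1. v \<in> B1 t}"
    "\<And>t. t \<in> A1 \<Longrightarrow> P (B1 t)"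
    "\<And>a b. \<lbrakk>adj a b; a \<in> F1; b \<in> F1\<rbrakk> \<Longrightarrow> \<exists>t\<in>A1. a \<in> B1 t \<and> b \<in> B1 t"
    using 1(6,7) unfolding tree_dec_def by simp_all
  have t2: "finite A2" "sym E2" "bridged E2" "conn_on E2 A2" "\<And>v. conn_on E2 {t \<in> A2. v \<in> B2 t}"
    "\<And>t. t \<in> A2 \<Longrightarrow> P (B2 t)"
    "\<And>a b. \<lbrakk>adj a b; a \<in> F2; b \<in> F2\<rbrakk> \<Longrightarrow> \<exists>t\<in>A2. a \<in> B2 t \<and> b \<in> B2 t"
    using 2(6,7) unfolding tree_dec_def by simp_all
  have symE: "sym E" using t1(1) t2(2) unfolding E_def by (auto simp: sym_def)
  have conn1: "conn_on E C" if "conn_on E1 C" for C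
    using that by (rule conn_on_mono) (auto simp: E_def)
  have conn2: "conn_on E C" if "conn_on E2 C" for C
    using that by (rule conn_on_mono) (auto simp: E_def)
  have "bridged E"
    unfolding bridged_def
  proof (intro allI impI)
    fix a b assume "(a, b) \<in> E"
    then consider "(a, b) \<in> E1" | "(a, b) \<in> E2" | "{a, b} = {r1, r2}" unfolding E_def by blast
    then show "(a, b) \<notin> (E - {(a, b), (b, a)})\<^sup>*"
    proof cases
      case 1
      have "E = E2 \<union> E1 \<union> {(r2, r1), (r1, r2)}" unfolding E_def by blast
      then show ?thesis
        using bridged_join[OF 2(2) \<open>E1 \<subseteq> _\<close> t1(2) _ 2(4) \<open>r1 \<in> A1\<close> 1] disj
        by (simp add: Int_commute)
    next
      case 2
      then show ?thesis
        using bridged_join[OF 1(2) \<open>E2 \<subseteq> _\<close> t2(3) disj 1(4) \<open>r2 \<in> A2\<close> 2] unfolding E_def by simp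
    next
      case 3
      \<comment> \<open>The joining edge is a bridge because no edge of \<open>E1\<close> or
        \<open>E2\<close> leads from \<open>A1\<close> to its complement or back.\<close>
      then have "E - {(a, b), (b, a)} \<subseteq> E1 \<union> E2" unfolding E_def doubleton_eq_iff by blast
      moreover have "(w \<in> A1) = (a \<in> A1)" if "(a, w) \<in> (E1 \<union> E2)\<^sup>*" for w
        using that by induction (use 1(2) 2(2) disj in auto)
      ultimately show ?thesis
        using 3 1(4) 2(4) disj rtrancl_mono[of "E - {(a, b), (b, a)}" "E1 \<union> E2"]
        unfolding doubleton_eq_iff by blast
    qed
  qed
  moreover have "conn_on E (A1 \<union> A2)"
    using 1(4) 2(4) conn1[OF t1(3)] conn2[OF t2(4)] symE
    by (intro conn_on_Un) (auto simp: E_def)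
  moreover have "conn_on E {t \<in> A1 \<union> A2. v \<in> B t}" for v
  proof -
    let ?C1 = "{t \<in> A1. v \<in> B1 t}" and ?C2 = "{t \<in> A2. v \<in> B2 t}"
    have "conn_on E (?C1 \<union> ?C2)"
    proof (rule conn_on_Un)
      assume "?C1 \<noteq> {}" "?C2 \<noteq> {}"
      \<comment> \<open>A vertex occurring in both trees lies in both root bags, so the joining edge
        links its occurrences.\<close>
      then have "v \<in> S1 \<inter> S2" using 1(6) 2(6) glue.hyps(3) by blast
      then show "\<exists>a\<in>?C1. \<exists>b\<in>?C2. (a, b) \<in> E"
        using 1(4,5) 2(4,5) unfolding E_def by blast
    qed (rule conn1[OF t1(4)] conn2[OF t2(5)] symE)+
    moreover have "{t \<in> A1 \<union> A2. v \<in> B t} = ?C1 \<union> ?C2" using B by auto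
    ultimately show ?thesis by simp
  qed
  moreover have "\<exists>t\<in>A1 \<union> A2. a \<in> B t \<and> b \<in> B t"
    if ab: "adj a b" "a \<in> \<Union>(B ` (A1 \<union> A2))" "b \<in> \<Union>(B ` (A1 \<union> A2))" for a b
  proof -
    have "a \<in> F1 \<union> F2" "b \<in> F1 \<union> F2" using ab F by auto
    then have "a \<in> F1 \<and> b \<in> F1 \<or> a \<in> F2 \<and> b \<in> F2"
      using glue.hyps(4)[of a b] glue.hyps(4)[of b a] ab(1) adj_sym[of a b] by blast
    then have "(\<exists>t\<in>A1. a \<in> B1 t \<and> b \<in> B1 t) \<or> (\<exists>t\<in>A2. a \<in> B2 t \<and> b \<in> B2 t)"
      using t1(6) t2(7) ab(1) by blast
    then show ?thesis using B by blast
  qed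
  moreover have "\<forall>t\<in>A1 \<union> A2. P (B t)" using t1(5) t2(6) B by auto
  ultimately have "tree_dec adj P (A1 \<union> A2) E B"
    using finA1 t2(1) symE unfolding tree_dec_def by simp
  moreover have "irrefl E" using 1(3,4) 2(3,4) disj unfolding E_def irrefl_def by blast
  moreover have "E \<subseteq> (A1 \<union> A2) \<times> (A1 \<union> A2)" using 1(2,4) 2(2,4) unfolding E_def by blast
  moreover have "\<Union>(B ` (A1 \<union> A2)) = F1 \<union> F2" using F by auto
  ultimately show ?case
    using AN B(1)[OF 1(4)] 1(4,5)
    by (intro exI[of _ "A1 \<union> A2"] exI[of _ E] exI[of _ B] exI[of _ r1]) auto
qed

section \<open>Tree decompositions of graphs\<close>

lemma rtrancl_on_iff_restricted:
  assumes "a \<in> A"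
  shows "(a, b) \<in> rtrancl_on A R \<longleftrightarrow> (a, b) \<in> (R \<inter> A \<times> A)\<^sup>*"
proof
  assume "(a, b) \<in> rtrancl_on A R"
  then show "(a, b) \<in> (R \<inter> A \<times> A)\<^sup>*"
  proof (induction rule: rtrancl_on_induct)
    case (step b c)
    then have "(b, c) \<in> R \<inter> A \<times> A" using in_rtrancl_on_in_F by blast
    then show ?case using step.IH by (rule rtrancl_into_rtrancl[rotated])
  qed simp
next
  assume "(a, b) \<in> (R \<inter> A \<times> A)\<^sup>*"
  then show "(a, b) \<in> rtrancl_on A R"
    by induction (use \<open>a \<in> A\<close> in \<open>auto intro: rtrancl_on_into_rtrancl_on\<close>)
qed

lemma arcs_ends_induce_subgraph: "arcs_ends (G \<restriction> S) = arcs_ends G \<inter> S \<times> S"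
  by (auto simp: arcs_ends_conv)

lemma connected_induce_iff_conn_on:
  assumes "sym (parcs T)"
  shows "Digraph_Component.connected (with_proj T \<restriction> A) \<longleftrightarrow> A \<noteq> {} \<and> conn_on (parcs T) A"
proof -
  have "symcl (parcs T \<inter> A \<times> A) = parcs T \<inter> A \<times> A"
    using assms by (auto simp: symcl_def sym_def)
  then show ?thesis
    unfolding connected_conv conn_on_def arcs_ends_induce_subgraph
    by (simp add: rtrancl_on_iff_restricted Int_assoc)
qed

lemma with_proj_induce_pverts:
  "parcs T \<subseteq> pverts T \<times> pverts T \<Longrightarrow> with_proj T \<restriction> pverts T = with_proj T"
  by (auto simp: induce_subgraph_def with_proj_def)

lemma graph_with_proj_iff:
  "graph (with_proj T) \<longleftrightarrow>
     finite (pverts T) \<and> parcs T \<subseteq> pverts T \<times> pverts T \<and> sym (parcs T) \<and> irrefl (parcs T)"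
proof
  assume "graph (with_proj T)"
  then interpret graph "with_proj T" .
  have "(a, b) \<in> parcs T \<Longrightarrow> a \<in> pverts T \<and> b \<in> pverts T \<and> a \<noteq> b" for a b
    using tail_in_verts[of "(a, b)"] head_in_verts[of "(a, b)"] no_loops[of "(a, b)"] by simp
  then show "finite (pverts T) \<and> parcs T \<subseteq> pverts T \<times> pverts T \<and> sym (parcs T) \<and> irrefl (parcs T)"
    using finite_verts sym_arcs by (auto simp: symmetric_def irrefl_def)
next
  assume T: "finite (pverts T) \<and> parcs T \<subseteq> pverts T \<times> pverts T \<and> sym (parcs T) \<and> irrefl (parcs T)"
  then have "finite (parcs T)" using finite_subset by blast
  with T show "graph (with_proj T)"
    by unfold_locales (auto simp: symmetric_def irrefl_def arc_to_ends_def)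
qed

section \<open>Cycles and bridges\<close>

lemma pcas_rtrancl: "pcas u p v \<Longrightarrow> (u, v) \<in> (set p)\<^sup>*"
proof (induction p arbitrary: u)
  case (Cons e p)
  then have "(snd e, v) \<in> (set (e # p))\<^sup>*" using rtrancl_mono[of "set p" "set (e # p)"] by auto
  moreover have "(u, snd e) \<in> set (e # p)" using Cons.prems by auto
  ultimately show ?case by (rule converse_rtrancl_into_rtrancl[rotated])
qed simp

lemma last_in_pawalk_verts: "pcas u p v \<Longrightarrow> v \<in> set (pawalk_verts u p)"
  by (induction p arbitrary: u) auto

lemma first_in_pawalk_verts: "pcas u p v \<Longrightarrow> u \<in> set (pawalk_verts u p)"
  by (cases p) auto

lemma arc_in_pawalk_verts:
  "pcas u p v \<Longrightarrow> (a, b) \<in> set p \<Longrightarrow> a \<in> set (pawalk_verts u p) \<and> b \<in> set (pawalk_verts u p)"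
  by (induction p arbitrary: u) (auto dest: first_in_pawalk_verts)

text \<open>A path around an edge \<open>a b\<close> closes up to a cycle with the arc
  \<open>(b, a)\<close>. Conversely, a cycle of at least three arcs without its first arc is a walk
  around that arc.\<close>

lemma undirected_tree_iff_bridged:
  assumes "graph (with_proj T)"
  shows "undirected_tree (with_proj T) \<longleftrightarrow>
    pverts T \<noteq> {} \<and> conn_on (parcs T) (pverts T) \<and> bridged (parcs T)"
proof -
  interpret graph "with_proj T" by fact
  have T: "parcs T \<subseteq> pverts T \<times> pverts T" "sym (parcs T)" "irrefl (parcs T)"
    using assms graph_with_proj_iff by blast+
  have conn: "Digraph_Component.connected (with_proj T) \<longleftrightarrow>
      pverts T \<noteq> {} \<and> conn_on (parcs T) (pverts T)"
    using connected_induce_iff_conn_on[OF T(2), of "pverts T"] with_proj_induce_pverts[OF T(1)] by simp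
  have "\<exists>p. cycle p \<and> length p \<ge> 3" if ab: "(a, b) \<in> parcs T"
      and path: "(a, b) \<in> (parcs T - {(a, b), (b, a)})\<^sup>*" for a b
  proof -
    define H where "H = T\<lparr>parcs := parcs T - {(a, b), (b, a)}\<rparr>"
    interpret H: pair_wf_digraph H using T(1) by unfold_locales (auto simp: H_def)
    have "a \<in> pverts H" using ab T(1) by (auto simp: H_def)
    have "parcs H \<inter> pverts H \<times> pverts H = parcs T - {(a, b), (b, a)}"
      using T(1) by (auto simp: H_def)
    then have "(a, b) \<in> (parcs H \<inter> pverts H \<times> pverts H)\<^sup>*" using path by simp
    then have "a \<rightarrow>\<^sup>*\<^bsub>with_proj H\<^esub> b"
      using rtrancl_on_iff_restricted[OF \<open>a \<in> pverts H\<close>] by (simp add: reachable_def)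
    then obtain p where p: "H.apath a p b" using H.reachable_apath by blast
    then have walk: "set p \<subseteq> parcs T - {(a, b), (b, a)}" "pcas a p b" "distinct (pawalk_verts a p)"
      unfolding H.apath_def H.awalk_def by (auto simp: H_def)
    \<comment> \<open>The path has distinct ends and avoids the arc \<open>(a, b)\<close>, so it has
      at least two arcs, and the closed cycle has at least three.\<close>
    have "length p \<ge> 2"
    proof (rule ccontr)
      assume "\<not> length p \<ge> 2"
      then consider "p = []" | e where "p = [e]" by (cases p) (auto simp: not_le less_Suc_eq_le)
      then show False
      proof cases
        case 1
        then show False using walk ab T(3) by (auto simp: irrefl_def)
      next
        case (2 e)
        then show False using walk by (cases e) auto
      qed
    qed
    moreover have "(b, a) \<in> parcs T" using ab T(2) by (auto dest: symD)
    moreover have "b \<in> pverts T" using ab T(1) by blast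
    ultimately have "awalk b ((b, a) # p) b \<and> distinct (tl (awalk_verts b ((b, a) # p))) \<and> length ((b, a) # p) \<ge> 3"
      using walk by (auto simp: awalk_def cas_with_proj_eq awalk_verts_with_proj_eq)
    then show ?thesis unfolding cycle_def by blast
  qed
  moreover have "\<not> bridged (parcs T)" if p: "cycle p" "length p \<ge> 3" for p
  proof -
    obtain u where u: "awalk u p u" "distinct (tl (awalk_verts u p))"
      using p(1) unfolding cycle_def by blast
    obtain e f g q where peq: "p = e # f # g # q"
      using p(2) by (auto simp: numeral_3_eq_3 Suc_le_length_iff)
    define w x y where "w = snd e" and "x = snd f" and "y = snd g"
    have arcs: "e = (u, w)" "f = (w, x)" "g = (x, y)" and walk: "pcas y q u" "set p \<subseteq> parcs T"
      using u(1) unfolding w_def x_def y_def peq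
      by (auto simp: awalk_def cas_with_proj_eq prod_eq_iff)
    have dist: "distinct (w # x # pawalk_verts y q)"
      using u(2) unfolding peq arcs by (simp add: awalk_verts_with_proj_eq)
    have "u \<in> set (pawalk_verts y q)" using walk(1) by (rule last_in_pawalk_verts)
    moreover have "y \<in> set (pawalk_verts y q)" using walk(1) by (rule first_in_pawalk_verts)
    moreover have "a \<in> set (pawalk_verts y q) \<and> b \<in> set (pawalk_verts y q)" if "(a, b) \<in> set q" for a b
      using walk(1) that by (rule arc_in_pawalk_verts)
    \<comment> \<open>Here three arcs matter: \<open>u\<close> is the last vertex of the remaining
      walk \<open>q\<close> from \<open>y\<close>, so it differs from \<open>x\<close>, and
      \<open>f\<close> is not the reverse of \<open>e\<close>.\<close>
    ultimately have "(u, w) \<notin> set (f # g # q)" "(w, u) \<notin> set (f # g # q)"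
      using dist unfolding arcs by auto
    then have "set (f # g # q) \<subseteq> parcs T - {(w, u), (u, w)}" using walk(2) unfolding peq by auto
    moreover have "(w, u) \<in> (set (f # g # q))\<^sup>*"
      using walk(1) by (intro pcas_rtrancl) (simp add: arcs)
    ultimately have "(w, u) \<in> (parcs T - {(w, u), (u, w)})\<^sup>*" using rtrancl_mono by blast
    moreover have "(w, u) \<in> parcs T" using walk(2) T(2) unfolding peq arcs by (auto dest: symD)
    ultimately show ?thesis unfolding bridged_def by blast
  qed
  ultimately show ?thesis using assms conn unfolding undirected_tree_def bridged_def by blast
qed

section \<open>The width bound for graphs\<close>

lemma (in graph) adjacency_arcs_ends: "adjacency (\<lambda>u v. u \<rightarrow> v)"
  by unfold_locales (use arcs_ends_symmetric[OF sym_arcs] adj_not_same in blast)+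

lemma matched_bag_if_matched:
  assumes "adjacency.matched (\<lambda>u v. u \<rightarrow>\<^bsub>G\<^esub> v) S" "adjacency (\<lambda>u v. u \<rightarrow>\<^bsub>G\<^esub> v)"
  shows "matched_bag G S"
proof -
  interpret adjacency "\<lambda>u v. u \<rightarrow>\<^bsub>G\<^esub> v" by fact
  have M: "matching (G \<restriction> S) M" if "edge_matching M" "\<Union>M \<subseteq> S" for M
  proof -
    have "\<exists>a b. e = {a, b} \<and> a \<rightarrow>\<^bsub>G \<restriction> S\<^esub> b" if e: "e \<in> M" for e
    proof -
      obtain a b where "a \<rightarrow>\<^bsub>G\<^esub> b" "e = {a, b}"
        using \<open>edge_matching M\<close> e unfolding edge_matching_def by blast
      then show ?thesis using e \<open>\<Union>M \<subseteq> S\<close> unfolding arcs_ends_induce_subgraph by blast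
    qed
    then show ?thesis
      using \<open>edge_matching M\<close> unfolding matching_def undirected_edges_def edge_matching_def by blast
  qed
  show ?thesis
    using assms(1) unfolding matched_def
  proof (elim disjE exE conjE bexE)
    fix N assume "edge_matching N" "\<Union>N = S"
    then show ?thesis unfolding matched_bag_def using M[of N] by (intro disjI1 exI[of _ N]) simp
  next
    fix N v u assume N: "edge_matching N" "v \<notin> \<Union>N" "S = insert v (\<Union>N)" "u \<in> \<Union>N" "v \<rightarrow>\<^bsub>G\<^esub> u"
    then have "\<Union>N = S - {v}" "matching (G \<restriction> S) N" "v \<in> S" using M[of N] by auto
    then show ?thesis
      unfolding matched_bag_def using N(4,5)
      by (intro disjI2 exI[of _ N] bexI[of _ v] conjI bexI[of _ u])
  qed
qed

text \<open>With maximum bag size \<open>K\<close> the given width is \<open>K - 1\<close>. Bags of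
  size at most \<open>2 * K\<close> then have width at most \<open>2 * K - 1\<close>, which is
  \<open>2 * (K - 1) + 1\<close>.\<close>

lemma matched_tree_decomposition_doubling:
  assumes "graph G" and no_isolated: "\<forall>v\<in>verts G. \<exists>u. v \<rightarrow>\<^bsub>G\<^esub> u"
    and TB: "tree_decomposition G T B"
  shows "\<exists>T' B'. matched_tree_decomposition G T' B' \<and> td_width T' B' \<le> 2 * td_width T B + 1"
proof -
  interpret G: graph G by fact
  let ?adj = "\<lambda>u v. u \<rightarrow>\<^bsub>G\<^esub> v"
  interpret adjacency ?adj by (rule G.adjacency_arcs_ends)
  have tree: "undirected_tree (with_proj T)" and sub: "\<And>t. t \<in> pverts T \<Longrightarrow> B t \<subseteq> verts G"
    and edge: "\<And>u v. u \<rightarrow>\<^bsub>G\<^esub> v \<Longrightarrow> \<exists>t\<in>pverts T. u \<in> B t \<and> v \<in> B t"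
    and occ: "\<And>v. v \<in> verts G \<Longrightarrow>
      Digraph_Component.connected (with_proj T \<restriction> {t \<in> pverts T. v \<in> B t})"
    using TB unfolding tree_decomposition_def by blast+
  have gT: "graph (with_proj T)" using tree unfolding undirected_tree_def by blast
  have T: "finite (pverts T)" "sym (parcs T)" using gT graph_with_proj_iff by blast+
  have T': "pverts T \<noteq> {}" "conn_on (parcs T) (pverts T)" "bridged (parcs T)"
    using tree undirected_tree_iff_bridged[OF gT] by blast+
  define K where "K = Max ((\<lambda>t. card (B t)) ` pverts T)"
  have K: "td_width T B = int K - 1"
  proof -
    have "int K = Max (int ` (\<lambda>t. card (B t)) ` pverts T)"
      unfolding K_def using T(1) T'(1) by (intro mono_Max_commute) (auto simp: mono_def)
    then show ?thesis unfolding td_width_def by (simp add: image_image)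
  qed
  have occ': "conn_on (parcs T) {t \<in> pverts T. v \<in> B t}" for v
  proof (cases "v \<in> verts G")
    case True
    then show ?thesis using occ connected_induce_iff_conn_on[OF T(2)] by simp
  next
    case False
    then have "{t \<in> pverts T. v \<in> B t} = {}" using sub by blast
    then show ?thesis by (simp only: conn_on_def ball_empty)
  qed
  have cover: "\<Union>(B ` pverts T) = verts G"
  proof
    show "verts G \<subseteq> \<Union>(B ` pverts T)"
    proof
      fix v assume "v \<in> verts G"
      then have "{t \<in> pverts T. v \<in> B t} \<noteq> {}"
        using occ connected_induce_iff_conn_on[OF T(2)] by simp
      then show "v \<in> \<Union>(B ` pverts T)" by blast
    qed
  qed (use sub in blast)
  have "small K (B t)" if "t \<in> pverts T" for t
    using that T(1) sub[OF that] finite_subset[OF _ G.finite_verts] unfolding small_def K_def by simp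
  then have "tree_dec ?adj (small K) (pverts T) (parcs T) B"
    unfolding tree_dec_def using T T' occ' edge by simp
  moreover obtain r where "r \<in> pverts T" using T'(1) by blast
  ultimately obtain n where "rooted_dec ?adj (small K) n (verts G) (B r)"
    using rooted_dec_of_tree_dec[of ?adj "small K" "pverts T" "parcs T" B r] cover by auto
  \<comment> \<open>The descent starts at the root with the empty matching.\<close>
  then obtain m Q where
    "rooted_dec ?adj (\<lambda>S. small (2 * K) S \<and> matched S) m (verts G \<union> \<Union>{}) Q"
    using matched_rooted_dec[of K n "verts G" "B r" "{}"] no_isolated G.adj_in_verts
    by (auto simp: edge_matching_def)
  then have "rooted_dec ?adj (\<lambda>S. small (2 * K) S \<and> matched S) m (verts G) Q" by simp
  from tree_dec_of_rooted_dec[OF this, of 0] obtain A E B' r' where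
    A: "E \<subseteq> A \<times> A" "irrefl E" "r' \<in> A" "\<Union>(B' ` A) = verts G"
      "tree_dec ?adj (\<lambda>S. small (2 * K) S \<and> matched S) A (E :: nat rel) B'"
    by (elim exE conjE) (rule that; assumption)
  define T2 where "T2 = \<lparr> pverts = A, parcs = E \<rparr>"
  have E: "finite A" "sym E" "bridged E" "conn_on E A" "\<And>v. conn_on E {t \<in> A. v \<in> B' t}"
    "\<And>t. t \<in> A \<Longrightarrow> small (2 * K) (B' t) \<and> matched (B' t)"
    "\<And>a b. \<lbrakk>a \<rightarrow>\<^bsub>G\<^esub> b; a \<in> verts G; b \<in> verts G\<rbrakk> \<Longrightarrow> \<exists>t\<in>A. a \<in> B' t \<and> b \<in> B' t"
    using A(4,5) unfolding tree_dec_def by simp_all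
  have "graph (with_proj T2)" using graph_with_proj_iff[of T2] A(1,2) E(1,2) by (simp add: T2_def)
  then have "undirected_tree (with_proj T2)"
    using undirected_tree_iff_bridged[of T2] A(3) E(3,4) by (auto simp: T2_def)
  moreover have "Digraph_Component.connected (with_proj T2 \<restriction> {t \<in> A. v \<in> B' t})" if "v \<in> verts G" for v
    using connected_induce_iff_conn_on[of T2 "{t \<in> A. v \<in> B' t}"] that A(4) E(2,5) by (auto simp: T2_def)
  ultimately have "tree_decomposition G T2 B'"
    unfolding tree_decomposition_def using A(4) E(7) G.adj_in_verts by (auto simp: T2_def)
  moreover have "\<forall>t\<in>A. matched_bag G (B' t)"
    using E(6) matched_bag_if_matched G.adjacency_arcs_ends by blast
  ultimately have "matched_tree_decomposition G T2 B'"
    unfolding matched_tree_decomposition_def by (simp add: T2_def)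
  moreover have "td_width T2 B' \<le> 2 * td_width T B + 1"
  proof -
    have "int (card (B' t)) \<le> 2 * int K" if "t \<in> A" for t
      using E(6)[OF that] unfolding small_def by linarith
    then have "Max ((\<lambda>t. int (card (B' t))) ` A) \<le> 2 * int K"
      using E(1) A(3) by (intro Max.boundedI) auto
    then show ?thesis unfolding K by (simp add: td_width_def T2_def)
  qed
  ultimately show ?thesis by blast
qed

text \<open>The hypothesis \<open>no_isolated\<close> cannot be dropped: an isolated vertex makes
  \<open>mtw G\<close> infinite by \<open>mtw_isolated\<close>, while \<open>tw G\<close> is finite
  by \<open>tw_finite\<close>.\<close>

theorem theorem7:
  fixes G :: "('a, 'b) pre_digraph"
  assumes "graph G"
    and no_isolated: "\<forall>v\<in>verts G. \<exists>u. v \<rightarrow>\<^bsub>G\<^esub> u"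
  shows "mtw G \<le> 2 * tw G + 1"
proof -
  let ?W = "{td_width T B | T B. tree_decomposition G T B}"
  have "?W \<noteq> {}"
  proof
    assume "?W = {}"
    then have "tw G = \<infinity>" unfolding tw_def by (simp add: top_ereal_def)
    then show False using tw_finite[OF assms(1)] by simp
  qed
  have low: "-1 \<le> w" if w: "w \<in> ?W" for w
  proof -
    obtain T B where "w = td_width T B" "tree_decomposition G T B" using w by blast
    then have fin: "finite (pverts T)" "pverts T \<noteq> {}"
      using graph_with_proj_iff undirected_tree_iff_bridged
      unfolding tree_decomposition_def undirected_tree_def by blast+
    then obtain t where "t \<in> pverts T" by blast
    then have "int (card (B t)) \<le> Max ((\<lambda>t. int (card (B t))) ` pverts T)" using fin by simp
    then show ?thesis unfolding \<open>w = _\<close> td_width_def by linarith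
  qed
  \<comment> \<open>Since widths are at least \<open>-1\<close>, the shift
    \<open>nat (w + 1)\<close> preserves their order and a least width exists; the infimum
    \<open>tw G\<close> is attained.\<close>
  obtain w where w: "w \<in> ?W" "\<And>w'. w' \<in> ?W \<Longrightarrow> w \<le> w'"
  proof -
    obtain w0 where "w0 \<in> ?W" using \<open>?W \<noteq> {}\<close> by blast
    then obtain w where "w \<in> ?W" "\<And>w'. w' \<in> ?W \<Longrightarrow> nat (w + 1) \<le> nat (w' + 1)"
      using ex_has_least_nat[of "\<lambda>w. w \<in> ?W" w0 "\<lambda>w. nat (w + 1)"] by blast
    then show ?thesis using that[of w] low by force
  qed
  have tw: "tw G = ereal (of_int w)"
    unfolding tw_def
  proof (rule Inf_eqI)
    fix y assume "\<And>i. i \<in> {ereal (of_int (td_width T B)) | T B. tree_decomposition G T B} \<Longrightarrow> y \<le> i"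
    then show "y \<le> ereal (of_int w)" using w(1) by blast
  next
    fix i assume "i \<in> {ereal (of_int (td_width T B)) | T B. tree_decomposition G T B}"
    then obtain w' where "w' \<in> ?W" "i = ereal (of_int w')" by blast
    then show "ereal (of_int w) \<le> i" using w(2) by (simp only: ereal_less_eq of_int_le_iff)
  qed
  obtain T B where TB: "w = td_width T B" "tree_decomposition G T B" using w by blast
  obtain T' B' where T': "matched_tree_decomposition G T' B'" "td_width T' B' \<le> 2 * w + 1"
    using matched_tree_decomposition_doubling[OF assms TB(2)] TB(1) by blast
  have "mtw G \<le> ereal (of_int (td_width T' B'))"
    unfolding mtw_def using T'(1) by (intro Inf_lower) blast
  also have "\<dots> \<le> ereal (of_int (2 * w + 1))" using T'(2) by (simp only: ereal_less_eq of_int_le_iff)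
  also have "\<dots> = 2 * ereal (of_int w) + 1" by (simp add: one_ereal_def numeral_eq_ereal)
  finally show ?thesis using tw by simp
qed

end
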